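(* Let $E$ and $F$ be Banach spaces, let $(G_0,G_1)$ be a Banach couple, let $\rho\in\mathcal{B}^{+-}$, and let $G$ be a Banach space of class $J_\rho(G_0,G_1)$. Let $T$ be a bounded bilinear operator from $E\times F$ into $G_0+G_1$ such that $T(E\times F)\subset G_0\cap G_1$, $T$ is compact from $E\times F$ into $G_0$, and $T$ is bounded from $E\times F$ into $G_1$. Then $T$ is compact from $E\times F$ into $G$.
   Context: A Banach couple $(X_0,X_1)$ is a pair of Banach spaces continuously embedded in a common Hausdorff topological vector space. $X_0\cap X_1$ has norm $\max\{\|x\|_{X_0},\|x\|_{X_1}\}$ and $X_0+X_1$ has norm $\inf_{x=x_0+x_1}(\|x_0\|_{X_0}+\|x_1\|_{X_1})$. A Banach space $X$ is intermediate with respect to $(X_0,X_1)$ if $X_0\cap X_1\hookrightarrow X\hookrightarrow X_0+X_1$ with bounded embeddings. A bounded bilinear map $T:E\times F\to G$ between Banach spaces is compact if the image of $\{(x,y)\in E\times F:\max\{\|x\|_E,\|y\|_F\}\le1\}$ is totally bounded in $G$. A function parameter is a continuous positive function $\rho$ on $(0,\infty)$. It belongs to $\mathcal{B}$ if $\rho(1)=1$ and $\overline{\rho}(s)=\sup_{t>0}\rho(st)/\rho(t)<\infty$ for all $s>0$. It belongs to $\mathcal{B}^{+-}$ if moreover $\int_0^\infty\min(1,1/t)\,\overline{\rho}(t)\,\frac{dt}{t}<\infty$. For $x\in X_0\cap X_1$ let $J(t,x)=\max\{\|x\|_{X_0},t\|x\|_{X_1}\}$. The space $(X_0,X_1)_{\rho,1;J}$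 consists of all $x\in X_0+X_1$ having a representation $x=\sum_{n\in\mathbb{Z}}u_n$ (convergence in $X_0+X_1$), $u_n\in X_0\cap X_1$, with $\|x\|_{\rho,1;J}=\inf\sum_{n}\rho(2^n)^{-1}J(2^n,u_n)<\infty$, the infimum being over all such representations. An intermediate space $X$ is of class $J_\rho(X_0,X_1)$ if $(X_0,X_1)_{\rho,1;J}\hookrightarrow X$ (bounded embedding). *)

theory Defs
  imports "HOL-Analysis.Analysis"
begin

section \<open>Normed subspaces of a Hausdorff topological vector space\<close>

class hausdorff_tvs = real_vector + topological_ab_group_add + t2_space +
  assumes tendsto_scaleR_nhds:
    "((\<lambda>p. fst p *\<^sub>R snd p) \<longlongrightarrow> c *\<^sub>R x) (nhds c \<times>\<^sub>F nhds x)"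

instance real_normed_vector \<subseteq> hausdorff_tvs
proof
  fix c :: real and x :: 'a
  show "((\<lambda>p. fst p *\<^sub>R snd p) \<longlongrightarrow> c *\<^sub>R x) (nhds c \<times>\<^sub>F nhds x)"
    by (intro tendsto_scaleR filterlim_fst filterlim_snd)
qed

text \<open>The spaces of a couple live inside one ambient vector space, so that sums, intersections
  and inclusions are literal. Only the values of the norm on the carrier are relevant.\<close>

record 'v nspace =
  carrier :: "'v set"
  nrm :: "'v \<Rightarrow> real"

definition normed_on :: "'v::real_vector nspace \<Rightarrow> bool" where
  "normed_on X \<longleftrightarrow> subspace (carrier X)
     \<and> (\<forall>x\<in>carrier X. 0 \<le> nrm X x \<and> (nrm X x = 0 \<longleftrightarrow> x = 0))
     \<and> (\<forall>c. \<forall>x\<in>carrier X. nrm X (c *\<^sub>R x) = \<bar>c\<bar> * nrm X x)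
     \<and> (\<forall>x\<in>carrier X. \<forall>y\<in>carrier X. nrm X (x + y) \<le> nrm X x + nrm X y)"

text \<open>The locale \<^locale>\<open>Metric_space\<close> asks for nonnegativity and symmetry also off the
  carrier, hence the default value 0.\<close>

definition ndist :: "'v::real_vector nspace \<Rightarrow> 'v \<Rightarrow> 'v \<Rightarrow> real" where
  "ndist X x y = (if x \<in> carrier X \<and> y \<in> carrier X then nrm X (x - y) else 0)"

lemma Metric_space_ndist:
  assumes "normed_on X"
  shows "Metric_space (carrier X) (ndist X)"
proof -
  have sub: "subspace (carrier X)"
    and pos: "\<And>x. x \<in> carrier X \<Longrightarrow> 0 \<le> nrm X x \<and> (nrm X x = 0 \<longleftrightarrow> x = 0)"
    and scale: "\<And>c x. x \<in> carrier X \<Longrightarrow> nrm X (c *\<^sub>R x) = \<bar>c\<bar> * nrm X x"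
    and tri: "\<And>x y. x \<in> carrier X \<Longrightarrow> y \<in> carrier X \<Longrightarrow> nrm X (x + y) \<le> nrm X x + nrm X y"
    using assms by (auto simp: normed_on_def)
  have diff: "x - y \<in> carrier X" if "x \<in> carrier X" "y \<in> carrier X" for x y
    using sub that by (rule subspace_diff)
  show ?thesis
  proof
    fix x y
    show "0 \<le> ndist X x y"
      using pos diff by (simp add: ndist_def)
    have "nrm X (y - x) = nrm X (x - y)" if "x \<in> carrier X" "y \<in> carrier X"
      using scale[OF diff[OF that], of "-1"] by simp
    then show "ndist X x y = ndist X y x"
      by (simp add: ndist_def)
  next
    fix x y assume "x \<in> carrier X" "y \<in> carrier X"
    then show "ndist X x y = 0 \<longleftrightarrow> x = y"
      using pos[OF diff] by (simp add: ndist_def)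
  next
    fix x y z assume "x \<in> carrier X" "y \<in> carrier X" "z \<in> carrier X"
    then show "ndist X x z \<le> ndist X x y + ndist X y z"
      using tri[OF diff diff, of x y y z] by (simp add: ndist_def)
  qed
qed

definition banach_on :: "'v::real_vector nspace \<Rightarrow> bool" where
  "banach_on X \<longleftrightarrow> normed_on X \<and> Metric_space.mcomplete (carrier X) (ndist X)"

definition continuously_embedded :: "'v::hausdorff_tvs nspace \<Rightarrow> bool" where
  "continuously_embedded X \<longleftrightarrow>
     continuous_map (Metric_space.mtopology (carrier X) (ndist X)) euclidean (\<lambda>x. x)"

definition banach_couple :: "'v::hausdorff_tvs nspace \<Rightarrow> 'v nspace \<Rightarrow> bool" where
  "banach_couple X0 X1 \<longleftrightarrow> banach_on X0 \<and> banach_on X1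
     \<and> continuously_embedded X0 \<and> continuously_embedded X1"

definition int_space :: "'v::real_vector nspace \<Rightarrow> 'v nspace \<Rightarrow> 'v nspace" where
  "int_space X0 X1 = \<lparr> carrier = carrier X0 \<inter> carrier X1,
     nrm = (\<lambda>x. max (nrm X0 x) (nrm X1 x)) \<rparr>"

definition sum_space :: "'v::real_vector nspace \<Rightarrow> 'v nspace \<Rightarrow> 'v nspace" where
  "sum_space X0 X1 = \<lparr> carrier = {x0 + x1 | x0 x1. x0 \<in> carrier X0 \<and> x1 \<in> carrier X1},
     nrm = (\<lambda>x. Inf {nrm X0 x0 + nrm X1 x1 | x0 x1.
                       x0 \<in> carrier X0 \<and> x1 \<in> carrier X1 \<and> x = x0 + x1}) \<rparr>"

text \<open>Bounded inclusion.\<close>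

definition embeds :: "'v::real_vector nspace \<Rightarrow> 'v nspace \<Rightarrow> bool" where
  "embeds X Y \<longleftrightarrow> carrier X \<subseteq> carrier Y \<and> (\<exists>C. \<forall>x\<in>carrier X. nrm Y x \<le> C * nrm X x)"

definition intermediate :: "'v::real_vector nspace \<Rightarrow> 'v nspace \<Rightarrow> 'v nspace \<Rightarrow> bool" where
  "intermediate X0 X1 X \<longleftrightarrow>
     banach_on X \<and> embeds (int_space X0 X1) X \<and> embeds X (sum_space X0 X1)"


section \<open>Bilinear maps\<close>

definition bounded_bilinear_into ::
    "('e::real_normed_vector \<Rightarrow> 'f::real_normed_vector \<Rightarrow> 'v::real_vector) \<Rightarrow> 'v nspace \<Rightarrow> bool" where
  "bounded_bilinear_into T X \<longleftrightarrow> bilinear T \<and> (\<forall>x y. T x y \<in> carrier X)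
     \<and> (\<exists>C. \<forall>x y. nrm X (T x y) \<le> C * norm x * norm y)"

definition compact_bilinear_into ::
    "('e::real_normed_vector \<Rightarrow> 'f::real_normed_vector \<Rightarrow> 'v::real_vector) \<Rightarrow> 'v nspace \<Rightarrow> bool" where
  "compact_bilinear_into T X \<longleftrightarrow> bounded_bilinear_into T X
     \<and> Metric_space.mtotally_bounded (carrier X) (ndist X)
         {T x y | x y. max (norm x) (norm y) \<le> 1}"


section \<open>Function parameters and the J-method\<close>

definition function_parameter :: "(real \<Rightarrow> real) \<Rightarrow> bool" where
  "function_parameter \<rho> \<longleftrightarrow> continuous_on {0<..} \<rho> \<and> (\<forall>t>0. 0 < \<rho> t)"

definition rho_bar :: "(real \<Rightarrow> real) \<Rightarrow> real \<Rightarrow> real" where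
  "rho_bar \<rho> s = (SUP t\<in>{0<..}. \<rho> (s * t) / \<rho> t)"

definition class_B :: "(real \<Rightarrow> real) set" where
  "class_B = {\<rho>. function_parameter \<rho> \<and> \<rho> 1 = 1
     \<and> (\<forall>s>0. bdd_above ((\<lambda>t. \<rho> (s * t) / \<rho> t) ` {0<..}))}"

definition class_B_pm :: "(real \<Rightarrow> real) set" where
  "class_B_pm = {\<rho> \<in> class_B.
     (\<integral>\<^sup>+ t\<in>{0<..}. ennreal (min 1 (1 / t) * rho_bar \<rho> t / t) \<partial>lborel) < \<infinity>}"

definition J_functional :: "'v nspace \<Rightarrow> 'v nspace \<Rightarrow> real \<Rightarrow> 'v \<Rightarrow> real" where
  "J_functional X0 X1 t x = max (nrm X0 x) (t * nrm X1 x)"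

text \<open>The two-sided series converges to \<open>x\<close> in \<open>X0 + X1\<close>, the upper and lower limits of
  summation tending to infinity independently.\<close>

definition J_representation ::
    "'v::real_vector nspace \<Rightarrow> 'v nspace \<Rightarrow> 'v \<Rightarrow> (int \<Rightarrow> 'v) \<Rightarrow> bool" where
  "J_representation X0 X1 x u \<longleftrightarrow> (\<forall>n. u n \<in> carrier (int_space X0 X1))
     \<and> ((\<lambda>(M, N). nrm (sum_space X0 X1) (x - (\<Sum>n = - int M..int N. u n))) \<longlongrightarrow> 0)
         (sequentially \<times>\<^sub>F sequentially)"

text \<open>The value is \<open>\<infinity>\<close> if no representation exists or if all of them have infinite cost.\<close>

definition J_norm ::
    "(real \<Rightarrow> real) \<Rightarrow> 'v::real_vector nspace \<Rightarrow> 'v nspace \<Rightarrow> 'v \<Rightarrow> ennreal" where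
  "J_norm \<rho> X0 X1 x = (INF u\<in>{u. J_representation X0 X1 x u}.
     \<Sum>\<^sub>\<infinity>n\<in>UNIV. ennreal (J_functional X0 X1 (2 powi n) (u n) / \<rho> (2 powi n)))"

definition J_space ::
    "(real \<Rightarrow> real) \<Rightarrow> 'v::real_vector nspace \<Rightarrow> 'v nspace \<Rightarrow> 'v nspace" where
  "J_space \<rho> X0 X1 = \<lparr> carrier = {x \<in> carrier (sum_space X0 X1). J_norm \<rho> X0 X1 x < \<infinity>},
     nrm = (\<lambda>x. enn2real (J_norm \<rho> X0 X1 x)) \<rparr>"

definition class_J ::
    "(real \<Rightarrow> real) \<Rightarrow> 'v::real_vector nspace \<Rightarrow> 'v nspace \<Rightarrow> 'v nspace \<Rightarrow> bool" where
  "class_J \<rho> X0 X1 X \<longleftrightarrow> intermediate X0 X1 X \<and> embeds (J_space \<rho> X0 X1) X"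

end

theory Submission
  imports Defs
begin

text \<open>Representing \<open>x \<in> G0 \<inter> G1\<close> by the series whose only nonzero term is \<open>x\<close>, at an arbitrary
  index \<open>n\<close>, gives \<open>\<parallel>x\<parallel>\<^sub>G \<le> C max(\<parallel>x\<parallel>\<^sub>0, 2\<^sup>n \<parallel>x\<parallel>\<^sub>1) / \<rho>(2\<^sup>n)\<close>. The integrability condition in
  \<open>\<B>\<^sup>+\<^sup>-\<close> forces \<open>2\<^sup>n / \<rho>(2\<^sup>n)\<close> to become arbitrarily small. Apply the bound to a
  difference of two points of the image of the unit ball: it is bounded in \<open>G1\<close>, so fixing \<open>n\<close>
  makes the second term small, and then closeness in \<open>G0\<close> makes the first term small.
  Hence finite nets in \<open>G0\<close> are finite nets in \<open>G\<close>.\<close>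

section \<open>One-term representations and the J-norm\<close>

lemma sum_space_zero:
  assumes "normed_on X0" "normed_on X1"
  shows "nrm (sum_space X0 X1) 0 = 0"
proof -
  let ?S = "{nrm X0 x0 + nrm X1 x1 | x0 x1. x0 \<in> carrier X0 \<and> x1 \<in> carrier X1 \<and> 0 = x0 + x1}"
  have zero: "0 \<in> carrier X0" "0 \<in> carrier X1" "nrm X0 0 = 0" "nrm X1 0 = 0"
    using assms by (auto simp: normed_on_def subspace_0)
  then have "0 \<in> ?S"
    by force
  moreover have "0 \<le> s" if "s \<in> ?S" for s
    using that assms by (auto simp: normed_on_def)
  ultimately have "Inf ?S = 0"
    by (intro cInf_eq_minimum) auto
  then show ?thesis
    by (simp add: sum_space_def)
qed

lemma J_representation_single:
  fixes X0 X1 :: "'v::real_vector nspace" and k :: int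
  assumes "normed_on X0" "normed_on X1" and x: "x \<in> carrier X0 \<inter> carrier X1"
  shows "J_representation X0 X1 x (\<lambda>n. if n = k then x else 0)"
proof -
  let ?u = "\<lambda>n. if n = k then x else 0"
  have partial: "(\<Sum>n = - int M..int N. ?u n) = x" if "nat \<bar>k\<bar> \<le> M" "nat \<bar>k\<bar> \<le> N" for M N
    using that by (subst sum.delta) auto
  \<comment> \<open>Once both summation limits have passed the absolute value of \<open>k\<close>,
    the remainder is exactly 0, so the double limit is that of an eventually constant
    function.\<close>
  have "\<forall>\<^sub>F p in sequentially \<times>\<^sub>F sequentially.
          (\<lambda>(M, N). nrm (sum_space X0 X1) (x - (\<Sum>n = - int M..int N. ?u n))) p = 0"
    unfolding eventually_prod_sequentially
    using partial sum_space_zero[OF assms(1,2)] by (intro exI[of _ "nat \<bar>k\<bar>"]) simp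
  then have "((\<lambda>(M, N). nrm (sum_space X0 X1) (x - (\<Sum>n = - int M..int N. ?u n))) \<longlongrightarrow> 0)
         (sequentially \<times>\<^sub>F sequentially)"
    by (rule tendsto_eventually)
  moreover have "0 \<in> carrier X0" "0 \<in> carrier X1"
    using assms by (auto simp: normed_on_def subspace_0)
  ultimately show ?thesis
    using x by (simp add: J_representation_def int_space_def)
qed

lemma J_norm_le:
  fixes X0 X1 :: "'v::real_vector nspace" and k :: int
  assumes "normed_on X0" "normed_on X1" "x \<in> carrier X0 \<inter> carrier X1"
  shows "J_norm \<rho> X0 X1 x \<le> ennreal (J_functional X0 X1 (2 powi k) x / \<rho> (2 powi k))"
proof -
  let ?u = "\<lambda>n. if n = k then x else 0"
  let ?f = "\<lambda>n. ennreal (J_functional X0 X1 (2 powi n) (?u n) / \<rho> (2 powi n))"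
  have "nrm X0 0 = 0" "nrm X1 0 = 0"
    using assms by (auto simp: normed_on_def subspace_0)
  then have "infsum ?f UNIV = infsum ?f {k}"
    by (intro infsum_cong_neutral) (auto simp: J_functional_def)
  moreover have "J_norm \<rho> X0 X1 x \<le> infsum ?f UNIV"
    unfolding J_norm_def using J_representation_single[OF assms] by (intro INF_lower) simp
  ultimately show ?thesis
    by simp
qed

text \<open>The constant comes from the embedding alone and is therefore independent of
  \<open>n\<close>; this leaves \<open>n\<close> free to be chosen later in terms of the accuracy
  sought.\<close>

lemma class_J_bound:
  fixes X0 X1 X :: "'v::real_vector nspace"
  assumes "normed_on X0" "normed_on X1" "function_parameter \<rho>" "class_J \<rho> X0 X1 X"
  obtains C where "C > 0"
    "\<And>x n. x \<in> carrier X0 \<inter> carrier X1 \<Longrightarrow>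
       nrm X x \<le> C * (J_functional X0 X1 (2 powi n) x / \<rho> (2 powi n))"
proof -
  obtain C where C: "\<And>x. x \<in> carrier (J_space \<rho> X0 X1) \<Longrightarrow> nrm X x \<le> C * nrm (J_space \<rho> X0 X1) x"
    using assms(4) by (auto simp: class_J_def embeds_def)
  \<comment> \<open>The embedding constant \<open>C\<close> has no prescribed sign; this replacement
    is positive.\<close>
  have "nrm X x \<le> (\<bar>C\<bar> + 1) * (J_functional X0 X1 (2 powi n) x / \<rho> (2 powi n))"
    if x: "x \<in> carrier X0 \<inter> carrier X1" for x n
  proof -
    let ?r = "J_functional X0 X1 (2 powi n) x / \<rho> (2 powi n)"
    have "0 \<in> carrier X1"
      using assms(2) by (simp add: normed_on_def subspace_0)
    then have "x \<in> carrier (sum_space X0 X1)"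
      using x by (force simp: sum_space_def)
    moreover have le: "J_norm \<rho> X0 X1 x \<le> ennreal ?r"
      by (rule J_norm_le[OF assms(1,2) x])
    then have "J_norm \<rho> X0 X1 x < \<infinity>"
      by (rule le_less_trans) simp
    ultimately have "nrm X x \<le> C * enn2real (J_norm \<rho> X0 X1 x)"
      using C[of x] by (simp add: J_space_def)
    also have "\<dots> \<le> (\<bar>C\<bar> + 1) * enn2real (J_norm \<rho> X0 X1 x)"
      by (intro mult_right_mono) auto
    also have "\<dots> \<le> (\<bar>C\<bar> + 1) * ?r"
    proof (intro mult_left_mono)
      \<comment> \<open>\<open>ennreal\<close> truncates negative numbers to 0, so
        \<open>enn2real\<close> returns \<open>?r\<close> only when \<open>?r\<close> is
        nonnegative.\<close>
      have "0 \<le> ?r"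
        using x assms(1,3) by (auto simp: normed_on_def function_parameter_def J_functional_def
            intro!: divide_nonneg_pos max.coboundedI1)
      then show "enn2real (J_norm \<rho> X0 X1 x) \<le> ?r"
        using enn2real_mono[OF le] by simp
    qed simp
    finally show ?thesis .
  qed
  then show thesis
    by (intro that[of "\<bar>C\<bar> + 1"]) auto
qed

section \<open>Consequences of the integrability condition\<close>

lemma nn_integral_inverse_Ici:
  assumes "c > 0"
  shows "(\<integral>\<^sup>+ t\<in>{1..}. ennreal (c / t) \<partial>lborel) = \<infinity>"
proof (rule ccontr)
  assume "(\<integral>\<^sup>+ t\<in>{1..}. ennreal (c / t) \<partial>lborel) \<noteq> \<infinity>"
  then obtain B where B: "0 \<le> B" "(\<integral>\<^sup>+ t\<in>{1..}. ennreal (c / t) \<partial>lborel) = ennreal B"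
    by (cases "\<integral>\<^sup>+ t\<in>{1..}. ennreal (c / t) \<partial>lborel") auto
  \<comment> \<open>With this \<open>R\<close> the integral over \<open>{1..R}\<close> is
    \<open>c * ln R = B + 1\<close>, which exceeds \<open>B\<close>.\<close>
  define R where "R = exp ((B + 1) / c)"
  have R: "1 \<le> R"
    using assms B by (simp add: R_def)
  have "(\<integral>\<^sup>+ t. ennreal (c / t) * indicator {1..R} t \<partial>lborel) = ennreal (c * ln R - c * ln 1)"
    using assms R by (intro nn_integral_FTC_Icc) (auto intro!: derivative_eq_intros)
  moreover have "(\<integral>\<^sup>+ t. ennreal (c / t) * indicator {1..R} t \<partial>lborel)
      \<le> (\<integral>\<^sup>+ t\<in>{1..}. ennreal (c / t) \<partial>lborel)"
    by (intro nn_integral_mono) (auto split: split_indicator)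
  ultimately have "c * ln R \<le> B"
    using B by simp
  then show False
    using assms by (simp add: R_def)
qed

text \<open>If \<open>t / \<rho> t \<ge> \<epsilon>\<close> at all \<open>t = 2\<^sup>n\<close>, then testing the supremum in \<open>rho_bar \<rho> s\<close> at
  \<open>t = 2\<^sup>-\<^sup>m\<close> with \<open>2\<^sup>m \<le> s < 2\<^sup>m\<^sup>+\<^sup>1\<close> gives \<open>rho_bar \<rho> s / s \<ge> c > 0\<close> for \<open>s \<ge> 1\<close>, because \<open>\<rho>\<close> is bounded
  below on \<open>[1, 2]\<close>; this contradicts the integrability condition at infinity.\<close>

lemma class_B_pm_ratio_small:
  assumes "\<rho> \<in> class_B_pm" and "\<epsilon> > 0"
  obtains n :: int where "2 powi n / \<rho> (2 powi n) < \<epsilon>"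
proof (rule ccontr)
  assume "\<not> thesis"
  then have large: "\<epsilon> \<le> 2 powi n / \<rho> (2 powi n)" for n :: int
    using that by (meson not_le)
  have cont: "continuous_on {0<..} \<rho>" and pos: "\<And>t. t > 0 \<Longrightarrow> 0 < \<rho> t"
    and bdd: "\<And>s. s > 0 \<Longrightarrow> bdd_above ((\<lambda>t. \<rho> (s * t) / \<rho> t) ` {0<..})"
    and fin: "(\<integral>\<^sup>+ t\<in>{0<..}. ennreal (min 1 (1 / t) * rho_bar \<rho> t / t) \<partial>lborel) < \<infinity>"
    using assms(1) by (auto simp: class_B_pm_def class_B_def function_parameter_def)
  have "continuous_on {1..2} \<rho>"
    by (rule continuous_on_subset[OF cont]) auto
  then obtain v where v: "v \<in> {1..2}" "\<And>u. u \<in> {1..2} \<Longrightarrow> \<rho> v \<le> \<rho> u"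
    using continuous_attains_inf[of "{1..2::real}" \<rho>] by force
  \<comment> \<open>The factor 1/2 compensates for dividing by \<open>u\<close>, which can be as
    large as 2.\<close>
  define c where "c = \<epsilon> * \<rho> v / 2"
  have c: "c > 0"
    using assms(2) pos[of v] v(1) by (simp add: c_def)
  have lower: "c \<le> rho_bar \<rho> s / s" if s: "1 \<le> s" for s
  proof -
    define m where "m = \<lfloor>log 2 s\<rfloor>"
    define u where "u = s * 2 powi (- m)"
    have p: "(2::real) powi m = 2 powr of_int m"
      by (simp add: powr_real_of_int')
    have "2 powi m \<le> s"
      unfolding p using s by (subst le_log_iff[symmetric]) (auto simp: m_def)
    moreover have "s < 2 powr (of_int m + 1)"
      using s by (simp add: m_def flip: log_less_iff)
    then have "s < 2 * 2 powi m"
      by (simp add: p powr_add)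
    ultimately have u: "1 \<le> u" "u \<le> 2"
      by (auto simp: u_def power_int_minus field_simps)
    have pw: "0 < (2::real) powi (- m)"
      by simp
    have "\<rho> v \<le> \<rho> u"
      using u by (intro v) auto
    have "\<epsilon> * \<rho> (2 powi (- m)) \<le> 2 powi (- m)"
      using large[of "- m"] pos[OF pw] by (simp add: pos_le_divide_eq)
    have "c * s \<le> \<epsilon> * \<rho> u * s / u"
    proof -
      have "\<epsilon> * \<rho> v * (u * s) \<le> \<epsilon> * \<rho> u * (2 * s)"
        using \<open>\<rho> v \<le> \<rho> u\<close> u s assms(2) pos[of u] pos[of v] v(1) by (intro mult_mono) auto
      then show ?thesis
        using u by (simp add: c_def field_simps)
    qed
    \<comment> \<open>Since \<open>s = u * 2 powi m\<close>, the quotient \<open>s / u\<close> is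
      the reciprocal of \<open>2 powi (- m)\<close>.\<close>
    also have "\<dots> = \<rho> u * (\<epsilon> / 2 powi (- m))"
      using u s by (simp add: u_def field_simps)
    also have "\<dots> \<le> \<rho> u * (1 / \<rho> (2 powi (- m)))"
    proof (intro mult_left_mono)
      show "\<epsilon> / 2 powi (- m) \<le> 1 / \<rho> (2 powi (- m))"
        using \<open>\<epsilon> * \<rho> (2 powi (- m)) \<le> 2 powi (- m)\<close> pos[OF pw] pw
        by (simp add: divide_simps mult.commute)
      show "0 \<le> \<rho> u"
        using pos[of u] u by simp
    qed
    also have "\<dots> = \<rho> (s * 2 powi (- m)) / \<rho> (2 powi (- m))"
      by (simp add: u_def)
    also have "\<dots> \<le> rho_bar \<rho> s"
      unfolding rho_bar_def using s pw by (intro cSUP_upper bdd) auto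
    finally show ?thesis
      using s by (simp add: pos_le_divide_eq)
  qed
  have "(\<integral>\<^sup>+ t\<in>{1..}. ennreal (c / t) \<partial>lborel)
      \<le> (\<integral>\<^sup>+ t\<in>{0<..}. ennreal (min 1 (1 / t) * rho_bar \<rho> t / t) \<partial>lborel)"
  proof (intro nn_integral_mono)
    fix t :: real
    \<comment> \<open>For t \<ge> 1 the minimum is \<open>1 / t\<close>, so the integrand is
      \<open>rho_bar \<rho> t / t\<close> divided once more by \<open>t\<close>.\<close>
    have "c / t \<le> min 1 (1 / t) * rho_bar \<rho> t / t" if "1 \<le> t"
      using divide_right_mono[OF lower[OF that], of t] that by (simp add: min_absorb2)
    then show "ennreal (c / t) * indicator {1..} t
        \<le> ennreal (min 1 (1 / t) * rho_bar \<rho> t / t) * indicator {0<..} t"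
      by (auto split: split_indicator intro: ennreal_leI)
  qed
  with fin nn_integral_inverse_Ici[OF c] show False
    by simp
qed

section \<open>Transfer of total boundedness from \<open>G0\<close> to \<open>G\<close>\<close>

theorem theorem4p1:
  fixes G0 G1 G :: "'v::hausdorff_tvs nspace"
    and \<rho> :: "real \<Rightarrow> real"
    and T :: "'e::banach \<Rightarrow> 'f::banach \<Rightarrow> 'v"
  assumes "banach_couple G0 G1"
    and "\<rho> \<in> class_B_pm"
    and "class_J \<rho> G0 G1 G"
    and "bounded_bilinear_into T (sum_space G0 G1)"
    and "\<forall>x y. T x y \<in> carrier G0 \<inter> carrier G1"
    and "compact_bilinear_into T G0"
    and "bounded_bilinear_into T G1"
  shows "compact_bilinear_into T G"
proof -
  have n0: "normed_on G0" and n1: "normed_on G1"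
    using assms(1) by (auto simp: banach_couple_def banach_on_def)
  have nG: "normed_on G" and sub: "carrier G0 \<inter> carrier G1 \<subseteq> carrier G"
    using assms(3)
    by (auto simp: class_J_def intermediate_def banach_on_def embeds_def int_space_def)
  have fp: "function_parameter \<rho>" and rho1: "\<rho> 1 = 1"
    using assms(2) by (auto simp: class_B_pm_def class_B_def)
  interpret M0: Metric_space "carrier G0" "ndist G0"
    by (rule Metric_space_ndist[OF n0])
  interpret MG: Metric_space "carrier G" "ndist G"
    by (rule Metric_space_ndist[OF nG])
  define K where "K = {T x y | x y. max (norm x) (norm y) \<le> 1}"
  obtain C where C: "C > 0"
    "\<And>x n. x \<in> carrier G0 \<inter> carrier G1 \<Longrightarrow>
       nrm G x \<le> C * (J_functional G0 G1 (2 powi n) x / \<rho> (2 powi n))"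
    using class_J_bound[OF n0 n1 fp assms(3)] by metis
  have T: "T x y \<in> carrier G0" "T x y \<in> carrier G1" for x y
    using assms(5) by auto
  obtain C0 where C0: "\<And>x y. nrm G0 (T x y) \<le> C0 * norm x * norm y"
    using assms(6) by (auto simp: compact_bilinear_into_def bounded_bilinear_into_def)
  obtain C1 where C1: "\<And>x y. nrm G1 (T x y) \<le> C1 * norm x * norm y"
    using assms(7) by (auto simp: bounded_bilinear_into_def)
  have "nrm G (T x y) \<le> (C * max C0 C1) * norm x * norm y" for x y
  proof -
    \<comment> \<open>At \<open>n = 0\<close> the normalisation \<open>\<rho> 1 = 1\<close> turns
      the bound into \<open>C\<close> times the intersection norm.\<close>
    have "nrm G (T x y) \<le> C * max (nrm G0 (T x y)) (nrm G1 (T x y))"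
      using C(2)[of "T x y" 0] T rho1 by (simp add: J_functional_def)
    also have "\<dots> \<le> C * (max C0 C1 * (norm x * norm y))"
    proof (intro mult_left_mono max.boundedI)
      have "C0 * (norm x * norm y) \<le> max C0 C1 * (norm x * norm y)"
        "C1 * (norm x * norm y) \<le> max C0 C1 * (norm x * norm y)"
        by (intro mult_right_mono; simp)+
      then show "nrm G0 (T x y) \<le> max C0 C1 * (norm x * norm y)"
        "nrm G1 (T x y) \<le> max C0 C1 * (norm x * norm y)"
        using C0[of x y] C1[of x y] by (simp_all add: mult.assoc)
    qed (use C(1) in simp)
    finally show ?thesis
      by (simp add: mult.assoc)
  qed
  then have bounded: "bounded_bilinear_into T G"
    using assms(4) T sub by (auto simp: bounded_bilinear_into_def)
  have K: "K \<subseteq> carrier G0 \<inter> carrier G1"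
    using T by (auto simp: K_def)
  \<comment> \<open>Adding 1 makes \<open>D\<close> positive, so that it may stand in the
    denominator of the threshold for \<open>n\<close>.\<close>
  define D where "D = \<bar>C1\<bar> + 1"
  have D: "nrm G1 z \<le> D" if z: "z \<in> K" for z
  proof -
    obtain x y where xy: "z = T x y" "norm x \<le> 1" "norm y \<le> 1"
      using z by (auto simp: K_def)
    have "C1 * norm x * norm y \<le> \<bar>C1\<bar> * (norm x * norm y)"
      by (simp add: mult.assoc mult_right_mono)
    also have "\<dots> \<le> \<bar>C1\<bar> * 1"
      using xy by (intro mult_left_mono mult_le_one) auto
    finally show ?thesis
      using C1[of x y] xy by (simp add: D_def)
  qed
  have diff1: "nrm G1 (z - w) \<le> 2 * D" if "z \<in> K" "w \<in> K" for z w
  proof -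
    have zw: "z \<in> carrier G1" "w \<in> carrier G1"
      using that K by auto
    have "- w \<in> carrier G1"
      using n1 zw by (simp add: normed_on_def subspace_neg)
    then have "nrm G1 (z + - w) \<le> nrm G1 z + nrm G1 (- w)"
      using n1 zw unfolding normed_on_def by blast
    moreover have "nrm G1 (- 1 *\<^sub>R w) = \<bar>- 1\<bar> * nrm G1 w"
      using n1 zw unfolding normed_on_def by blast
    ultimately show ?thesis
      using D[OF that(1)] D[OF that(2)] by simp
  qed
  have "MG.mtotally_bounded K"
    unfolding MG.mtotally_bounded_def
  proof (intro allI impI)
    fix e :: real assume e: "e > 0"
    have "D > 0"
      by (simp add: D_def)
    then obtain n :: int where n: "2 powi n / \<rho> (2 powi n) < e / (C * (2 * D))"
      using class_B_pm_ratio_small[OF assms(2), of "e / (C * (2 * D))"] e C(1) by auto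
    let ?r = "\<rho> (2 powi n)"
    have r: "?r > 0"
      using fp by (simp add: function_parameter_def)
    \<comment> \<open>This \<open>d\<close> satisfies \<open>C * d / ?r = e\<close>, and the choice
      of \<open>n\<close> says precisely that \<open>2 powi n * (2 * D) < d\<close>.\<close>
    define d where "d = e * ?r / C"
    have "d > 0"
      using e r C(1) by (simp add: d_def)
    \<comment> \<open>The centres lie in \<open>K\<close> itself, so the \<open>G1\<close> bound on
      differences applies to a centre and a point of its ball.\<close>
    then obtain N where N: "finite N" "N \<subseteq> K" "K \<subseteq> (\<Union>x\<in>N. M0.mball x d)"
      using assms(6) by (auto simp: compact_bilinear_into_def M0.mtotally_bounded_def K_def)
    have "K \<subseteq> (\<Union>x\<in>N. MG.mball x e)"
    proof
      fix z assume z: "z \<in> K"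
      then obtain w where w: "w \<in> N" "z \<in> M0.mball w d"
        using N(3) by auto
      have wK: "w \<in> K"
        using w(1) N(2) by auto
      have carr: "z \<in> carrier G0" "w \<in> carrier G0" "z \<in> carrier G1" "w \<in> carrier G1"
        using K z wK by auto
      have "w - z \<in> carrier G0 \<inter> carrier G1"
        using carr n0 n1 by (auto simp: normed_on_def intro: subspace_diff)
      then have "nrm G (w - z) \<le> C * (J_functional G0 G1 (2 powi n) (w - z) / ?r)"
        by (rule C(2))
      also have "\<dots> < e"
      proof -
        have "nrm G0 (w - z) < d"
          using w(2) carr by (simp add: ndist_def)
        moreover have "2 powi n * nrm G1 (w - z) < d"
        proof -
          have "2 powi n * nrm G1 (w - z) \<le> 2 powi n * (2 * D)"
            using diff1[OF wK z] by (intro mult_left_mono) auto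
          also have "\<dots> < d"
            using n r C(1) \<open>D > 0\<close> by (simp add: d_def field_simps)
          finally show ?thesis .
        qed
        ultimately have "J_functional G0 G1 (2 powi n) (w - z) < d"
          by (simp add: J_functional_def)
        then show ?thesis
          using r C(1) by (simp add: d_def field_simps)
      qed
      finally have "z \<in> MG.mball w e"
        using sub carr by (auto simp: ndist_def)
      then show "z \<in> (\<Union>x\<in>N. MG.mball x e)"
        using w(1) by auto
    qed
    then show "\<exists>N. finite N \<and> N \<subseteq> K \<and> K \<subseteq> (\<Union>x\<in>N. MG.mball x e)"
      using N by blast
  qed
  with bounded show ?thesis
    by (simp add: compact_bilinear_into_def K_def)
qed

end
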